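(* Let $h:\mathbb{R}^n\to\mathbb{R}\cup\{\pm\infty\}$ be a proper function, let $\overline{x}\in\operatorname{argmin}_{\mathbb{R}^n}h$, and let $\gamma\ge 0$. Then $h$ is (strongly) star quasiconvex with modulus $\gamma$ with respect to $\overline{x}$ if and only if the restriction of $h$ to every half line $\{\overline{x}+tu: t\ge 0\}$, $u\in\mathbb{R}^n$, emanating from $\overline{x}$ is (strongly) quasiconvex with the same modulus $\gamma$.
   Context: $h$ is proper if $\operatorname{dom}h:=\{x: h(x)<+\infty\}\neq\emptyset$ and $h>-\infty$ everywhere. $\operatorname{argmin}_{\mathbb{R}^n}h$ is the set of global minimizers. For $\overline{x}\in\operatorname{argmin}_{\mathbb{R}^n}h$ and $\gamma\ge 0$, $h$ is (strongly) star quasiconvex with modulus $\gamma$ with respect to $\overline{x}$ if for every $y\in\operatorname{dom}h$ and $\lambda\in[0,1]$, $$h(\lambda\overline{x}+(1-\lambda)y)\le h(y)-\lambda(1-\lambda)\frac{\gamma}{2}\|y-\overline{x}\|^2$$ ("strongly" corresponds to $\gamma>0$). The restriction of $h$ to a half line $R$ is (strongly) quasiconvex with modulus $\gamma\ge0$ if $R\cap\operatorname{dom}h$ is convex and for all $x,y\in R\cap\operatorname{dom}h$ and $\lambda\in[0,1]$, $$h(\lambda y+(1-\lambda)x)\le\max\{h(y),h(x)\}-\lambda(1-\lambda)\frac{\gamma}{2}\|x-y\|^2.$$ *)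

theory Defs
  imports "HOL-Analysis.Analysis"
begin

definition edom :: "('a \<Rightarrow> ereal) \<Rightarrow> 'a set" where
  "edom h = {x. h x < \<infinity>}"

definition proper :: "('a \<Rightarrow> ereal) \<Rightarrow> bool" where
  "proper h \<longleftrightarrow> edom h \<noteq> {} \<and> (\<forall>x. h x > -\<infinity>)"

definition argmin_set :: "('a \<Rightarrow> ereal) \<Rightarrow> 'a set" where
  "argmin_set h = {x. \<forall>y. h x \<le> h y}"

text \<open>
  In the next two definitions the modulus \<open>\<gamma>\<close> is meant to be nonnegative, and the point \<open>xbar\<close> to
  be a global minimizer of \<open>h\<close>; \<open>\<gamma> = 0\<close> gives the plain notion and \<open>\<gamma> > 0\<close> the strong one. For proper
  \<open>h\<close>, all values of \<open>h\<close> on the right-hand sides are finite, so \<open>ereal\<close> subtraction is never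
  applied to an infinite value.
\<close>

definition star_quasiconvex :: "real \<Rightarrow> 'a::real_normed_vector \<Rightarrow> ('a \<Rightarrow> ereal) \<Rightarrow> bool" where
  "star_quasiconvex \<gamma> xbar h \<longleftrightarrow>
    (\<forall>y\<in>edom h. \<forall>l\<in>{0..1::real}.
      h (l *\<^sub>R xbar + (1 - l) *\<^sub>R y)
        \<le> h y - ereal (l * (1 - l) * (\<gamma> / 2) * (norm (y - xbar))\<^sup>2))"

definition quasiconvex_restr :: "real \<Rightarrow> 'a::real_normed_vector set \<Rightarrow> ('a \<Rightarrow> ereal) \<Rightarrow> bool" where
  "quasiconvex_restr \<gamma> R h \<longleftrightarrow>
    convex (R \<inter> edom h) \<and>
    (\<forall>x\<in>R \<inter> edom h. \<forall>y\<in>R \<inter> edom h. \<forall>l\<in>{0..1::real}.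
      h (l *\<^sub>R y + (1 - l) *\<^sub>R x)
        \<le> max (h y) (h x) - ereal (l * (1 - l) * (\<gamma> / 2) * (norm (x - y))\<^sup>2))"

definition half_line :: "'a::real_vector \<Rightarrow> 'a \<Rightarrow> 'a set" where
  "half_line xbar u = {xbar + t *\<^sub>R u | t::real. t \<ge> 0}"

end

theory Submission
  imports Defs
begin

text \<open>
  On a half line, write \<open>x = xbar + s u\<close>, \<open>y = xbar + t u\<close> with \<open>s \<le> t\<close>, and let
  \<open>z = xbar + r u\<close> be a point between them. Star quasiconvexity applied to \<open>y\<close> bounds \<open>h z\<close> by
  \<open>h y\<close> minus \<open>\<gamma>/2 * norm u^2\<close> times \<open>(t - r) * r\<close>, and quasiconvexity on the half line only
  asks for the smaller gain \<open>(t - r) * (r - s)\<close>. Conversely, star quasiconvexity at \<open>y\<close> is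
  quasiconvexity between \<open>y\<close> and the minimizer \<open>xbar\<close>.
\<close>

lemma convex_half_line: "convex (half_line xbar u)"
proof -
  have "half_line xbar u = (\<lambda>x. xbar + x) ` (\<lambda>t. t *\<^sub>R u) ` {0..}"
    by (auto simp: half_line_def image_iff)
  moreover have "convex ((\<lambda>t. t *\<^sub>R u) ` {0..})"
    by (intro convex_linear_image linearI convex_real_interval) (auto simp: algebra_simps)
  ultimately show ?thesis
    by (simp add: convex_translation)
qed

text \<open>Stated in line parameters so that it serves both orders of two points on the ray:
  \<open>t\<close> is the larger parameter, \<open>s\<close> the smaller one, and \<open>s\<close>
  enters only through the gain.\<close>

lemma star_quasiconvex_half_line_le:
  fixes xbar u :: "'a::real_normed_vector"
  assumes star: "star_quasiconvex \<gamma> xbar h" and \<gamma>: "0 \<le> \<gamma>"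
    and dom: "xbar + t *\<^sub>R u \<in> edom h"
    and ord: "0 \<le> s" "s \<le> r" "r \<le> t"
  shows "h (xbar + r *\<^sub>R u)
    \<le> h (xbar + t *\<^sub>R u) - ereal ((t - r) * (r - s) * (\<gamma> / 2) * (norm u)\<^sup>2)"
proof (cases "t = 0")
  case True
  with ord have "r = 0" "s = 0" by simp_all
  with True show ?thesis by (simp flip: zero_ereal_def)
next
  case False
  with ord have t: "t > 0" by simp
  \<comment> \<open>The weight on \<open>xbar\<close> is the solution of
    \<open>(1 - m) * t = r\<close>. The division by \<open>t\<close> is why \<open>t = 0\<close>,
    where the ray segment collapses to \<open>xbar\<close>, is treated separately.\<close>
  define m where "m = 1 - r / t"
  have m: "m \<in> {0..1}" using ord t by (auto simp: m_def field_simps)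
  have mt: "(1 - m) * t = r" using t by (simp add: m_def)
  have pt: "m *\<^sub>R xbar + (1 - m) *\<^sub>R (xbar + t *\<^sub>R u) = xbar + r *\<^sub>R u"
    using mt by (simp add: scaleR_add_right flip: add.assoc scaleR_add_left)
  have "m * (1 - m) * t\<^sup>2 = (t - r) * r"
    using t by (simp add: m_def field_simps power2_eq_square)
  then have gain: "m * (1 - m) * (\<gamma> / 2) * (norm (t *\<^sub>R u))\<^sup>2
      = (t - r) * r * ((\<gamma> / 2) * (norm u)\<^sup>2)"
    by (simp add: power_mult_distrib)
  \<comment> \<open>Here \<open>0 \<le> s\<close> gives \<open>r - s \<le> r\<close>; the remaining
    factors are nonnegative because \<open>r \<le> t\<close> and
    \<open>0 \<le> \<gamma>\<close>.\<close>
  have "(t - r) * (r - s) * ((\<gamma> / 2) * (norm u)\<^sup>2) \<le> (t - r) * r * ((\<gamma> / 2) * (norm u)\<^sup>2)"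
    using ord \<gamma> by (intro mult_right_mono mult_left_mono) auto
  then have "ereal ((t - r) * (r - s) * (\<gamma> / 2) * (norm u)\<^sup>2)
      \<le> ereal (m * (1 - m) * (\<gamma> / 2) * (norm (t *\<^sub>R u))\<^sup>2)"
    unfolding gain by (simp add: mult.assoc)
  moreover have "h (xbar + r *\<^sub>R u) \<le> h (xbar + t *\<^sub>R u)
      - ereal (m * (1 - m) * (\<gamma> / 2) * (norm (t *\<^sub>R u))\<^sup>2)"
    using star[unfolded star_quasiconvex_def, rule_format, OF dom m] unfolding pt by simp
  ultimately show ?thesis
    by (meson ereal_minus_mono order_refl order_trans)
qed

lemma star_quasiconvex_imp_quasiconvex_restr:
  fixes xbar u :: "'a::real_normed_vector"
  assumes star: "star_quasiconvex \<gamma> xbar h" and \<gamma>: "0 \<le> \<gamma>"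
  shows "quasiconvex_restr \<gamma> (half_line xbar u) h"
proof -
  let ?D = "half_line xbar u \<inter> edom h"
  have bound: "h (l *\<^sub>R y + (1 - l) *\<^sub>R x)
      \<le> max (h y) (h x) - ereal (l * (1 - l) * (\<gamma> / 2) * (norm (x - y))\<^sup>2)"
    if x: "x \<in> ?D" and y: "y \<in> ?D" and l: "l \<in> {0..1}" for x y l
  proof -
    obtain s where s: "x = xbar + s *\<^sub>R u" "0 \<le> s" using x by (auto simp: half_line_def)
    obtain t where t: "y = xbar + t *\<^sub>R u" "0 \<le> t" using y by (auto simp: half_line_def)
    define r where "r = l * t + (1 - l) * s"
    have z: "l *\<^sub>R y + (1 - l) *\<^sub>R x = xbar + r *\<^sub>R u"
      by (simp add: s t r_def algebra_simps)
    have "norm (x - y) = \<bar>s - t\<bar> * norm u"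
      by (simp add: s t flip: scaleR_diff_left)
    then have norm2: "(norm (x - y))\<^sup>2 = (s - t)\<^sup>2 * (norm u)\<^sup>2"
      by (simp add: power_mult_distrib)
    have r_t: "t - r = (1 - l) * (t - s)" and r_s: "r - s = l * (t - s)"
      by (simp_all add: r_def algebra_simps)
    \<comment> \<open>This identity makes the modulus come out exactly the same. It holds for either
      order of \<open>s\<close> and \<open>t\<close>, so both cases below use it.\<close>
    have gain: "(t - r) * (r - s) = l * (1 - l) * (s - t)\<^sup>2"
      unfolding r_t r_s by (simp add: power2_eq_square algebra_simps)
    show ?thesis
    proof (cases "s \<le> t")
      case True
      then have "0 \<le> t - r" "0 \<le> r - s"
        unfolding r_t r_s using l by auto
      then have "h (xbar + r *\<^sub>R u)
          \<le> h y - ereal ((t - r) * (r - s) * (\<gamma> / 2) * (norm u)\<^sup>2)"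
        using star_quasiconvex_half_line_le[OF star \<gamma>, of t u s r] s t y by simp
      also have "\<dots> \<le> max (h y) (h x) - ereal ((t - r) * (r - s) * (\<gamma> / 2) * (norm u)\<^sup>2)"
        by (intro ereal_minus_mono) auto
      finally show ?thesis
        unfolding z norm2 gain by (simp add: mult_ac)
    next
      \<comment> \<open>The points swap roles, so \<open>h x\<close> is now the bounding value; both
        factors of the gain change sign and their product stays the same.\<close>
      case False
      then have "t - r \<le> 0" "r - s \<le> 0"
        unfolding r_t r_s using l by (auto simp: mult_le_0_iff)
      then have "h (xbar + r *\<^sub>R u)
          \<le> h x - ereal ((s - r) * (r - t) * (\<gamma> / 2) * (norm u)\<^sup>2)"
        using star_quasiconvex_half_line_le[OF star \<gamma>, of s u t r] s t x by simp
      also have "(s - r) * (r - t) = (t - r) * (r - s)"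
        by (simp add: algebra_simps)
      also have "h x - ereal ((t - r) * (r - s) * (\<gamma> / 2) * (norm u)\<^sup>2)
          \<le> max (h y) (h x) - ereal ((t - r) * (r - s) * (\<gamma> / 2) * (norm u)\<^sup>2)"
        by (intro ereal_minus_mono) auto
      finally show ?thesis
        unfolding z norm2 gain by (simp add: mult_ac)
    qed
  qed
  \<comment> \<open>Convexity of the domain on the ray comes from the inequality itself: its
    right-hand side is a value below infinity minus a real number.\<close>
  have "l *\<^sub>R y + (1 - l) *\<^sub>R x \<in> edom h"
    if "x \<in> ?D" "y \<in> ?D" "l \<in> {0..1}" for x y l
  proof -
    have "max (h y) (h x) < \<infinity>" using that by (simp add: edom_def max_def)
    then have "max (h y) (h x) - ereal (l * (1 - l) * (\<gamma> / 2) * (norm (x - y))\<^sup>2) < \<infinity>"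
      by (cases "max (h y) (h x)") simp_all
    with bound[OF that] show ?thesis
      unfolding edom_def by (auto intro: le_less_trans)
  qed
  moreover have "l *\<^sub>R y + (1 - l) *\<^sub>R x \<in> half_line xbar u"
    if "x \<in> ?D" "y \<in> ?D" "l \<in> {0..1}" for x y l
    using that by (intro convexD[OF convex_half_line]) auto
  ultimately have "convex ?D"
    by (simp add: convex_alt add.commute)
  with bound show ?thesis
    by (auto simp: quasiconvex_restr_def)
qed

text \<open>Minimality of \<open>xbar\<close> acts twice: it puts \<open>xbar\<close> into
  \<open>edom h\<close> as soon as some \<open>y\<close> is there, and it reduces the maximum of
  \<open>h xbar\<close> and \<open>h y\<close> to \<open>h y\<close>.\<close>

lemma quasiconvex_restr_imp_star_quasiconvex:
  fixes xbar :: "'a::real_normed_vector"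
  assumes min: "xbar \<in> argmin_set h"
    and restr: "\<And>u. quasiconvex_restr \<gamma> (half_line xbar u) h"
  shows "star_quasiconvex \<gamma> xbar h"
  unfolding star_quasiconvex_def
proof (intro ballI)
  fix y l assume y: "y \<in> edom h" and l: "l \<in> {0..1::real}"
  have le: "h xbar \<le> h y" using min by (simp add: argmin_set_def)
  \<comment> \<open>The direction \<open>y - xbar\<close> places \<open>xbar\<close> and
    \<open>y\<close> on one ray, at parameters 0 and 1.\<close>
  have "xbar = xbar + 0 *\<^sub>R (y - xbar)" "y = xbar + 1 *\<^sub>R (y - xbar)" by simp_all
  then have "xbar \<in> half_line xbar (y - xbar)" "y \<in> half_line xbar (y - xbar)"
    unfolding half_line_def by (blast intro: order_refl zero_le_one)+
  moreover have "xbar \<in> edom h" using le y by (auto simp: edom_def intro: le_less_trans)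
  ultimately have "h (l *\<^sub>R xbar + (1 - l) *\<^sub>R y)
      \<le> max (h xbar) (h y) - ereal (l * (1 - l) * (\<gamma> / 2) * (norm (y - xbar))\<^sup>2)"
    using restr[of "y - xbar"] y l unfolding quasiconvex_restr_def by blast
  then show "h (l *\<^sub>R xbar + (1 - l) *\<^sub>R y)
      \<le> h y - ereal (l * (1 - l) * (\<gamma> / 2) * (norm (y - xbar))\<^sup>2)"
    using le by (simp add: max_absorb2)
qed

theorem theorem12:
  fixes h :: "real ^ 'n \<Rightarrow> ereal" and xbar :: "real ^ 'n" and \<gamma> :: real
  assumes "proper h"
    and "xbar \<in> argmin_set h"
    and "\<gamma> \<ge> 0"
  shows "star_quasiconvex \<gamma> xbar h \<longleftrightarrow>
    (\<forall>u :: real ^ 'n. quasiconvex_restr \<gamma> (half_line xbar u) h)"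
  using assms star_quasiconvex_imp_quasiconvex_restr quasiconvex_restr_imp_star_quasiconvex
  by blast

end
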